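(* Let $(W,S)$ be an irreducible Coxeter group of finite rank with $m_{st}<\infty$ for all $s,t\in S$, whose Coxeter graph $G=(S,E)$ contains at least two circuits. Let $V=\bigoplus_{n\in\mathbb{Z},\,s\in S}\mathbb{C}\alpha_{s,n}$ be the representation of $W$ defined in the context (for any spanning tree $T=(S,E_0)$ of $G$ and any two distinct edges $\{s_1,t_1\},\{s_2,t_2\}\in E\setminus E_0$), and let $$V_0:=\{v\in V\mid s\cdot v=v \text{ for all } s\in S\}.$$ Then the representation $V/V_0$ of $W$ is irreducible and infinite dimensional.
   Context: For $s,t\in S$, $m_{st}$ is the order of $st$ in $W$. The Coxeter graph $G=(S,E)$ has vertex set $S$ and an edge $\{s,t\}\in E$ whenever $m_{st}\ge 3$; labels $m_{st}$ are ignored when regarding $G$ as a graph (a simple undirected graph). Irreducible of finite rank means $G$ is connected and $|S|<\infty$. A circuit is a closed path $(r_1,\dots,r_n=r_1)$ in $G$ with $r_1,\dots,r_{n-1}$ distinct and $n-1\ge 3$, considered up to choice of starting point and direction. A spanning tree of $G$ is a tree $T=(S,E_0)$ with $E_0\subseteq E$. If $G$ has at least two circuits, then $|E\setminus E_0|\ge 2$. Construction of $V$. Fix a spanning tree $T=(S,E_0)$ of $G$ and two distinct edges $\{s_1,t_1\},\{s_2,t_2\}\in E\setminus E_0$, each with its two endpoints named as indicated (the two edges may share a vertex). Let $V$ be the complex vector space with basis $\{\alpha_{s,n}\mid s\in S,\ n\in\mathbb{Z}\}$. Each $s\in S$ acts linearly on $V$ as follows, for all $n\in\mathbb{Z}$: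 (1) $s\cdot\alpha_{s,n}:=-\alpha_{s,n}$; (2) $s_1\cdot\alpha_{t_1,n}:=\alpha_{t_1,n}+2\cos\frac{\pi}{m_{s_1t_1}}\,\alpha_{s_1,n+1}$, $t_1\cdot\alpha_{s_1,n+1}:=\alpha_{s_1,n+1}+2\cos\frac{\pi}{m_{s_1t_1}}\,\alpha_{t_1,n}$, $s_2\cdot\alpha_{t_2,n}:=\alpha_{t_2,n}+2^{n+1}\cos\frac{\pi}{m_{s_2t_2}}\,\alpha_{s_2,n+1}$, $t_2\cdot\alpha_{s_2,n+1}:=\alpha_{s_2,n+1}+2^{-n+1}\cos\frac{\pi}{m_{s_2t_2}}\,\alpha_{t_2,n}$; (3) if $s\ne t$ and the unordered pair $\{s,t\}$ is neither $\{s_1,t_1\}$ nor $\{s_2,t_2\}$, then $s\cdot\alpha_{t,n}:=\alpha_{t,n}+2\cos\frac{\pi}{m_{st}}\,\alpha_{s,n}$. These formulas define a representation of $W$ on $V$. *)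

theory Defs
  imports
    Complex_Main
    "HOL-Algebra.Multiplicative_Group"
    "HOL-Algebra.Generated_Groups"
    "Jordan_Normal_Form.VS_Connect"
begin

section \<open>Finite simple graphs, given by a vertex set and a set of two-element edges\<close>

definition graph_connected :: "'a set \<Rightarrow> 'a set set \<Rightarrow> bool" where
  "graph_connected S E \<longleftrightarrow> (\<forall>x\<in>S. \<forall>y\<in>S. (x, y) \<in> {(u, v). {u, v} \<in> E}\<^sup>*)"

text \<open>A circuit is the list \<open>[r\<^sub>1, \<dots>, r\<^sub>n]\<close> with \<open>r\<^sub>n = r\<^sub>1\<close>; in particular it has
  at least four entries.\<close>

definition circuit :: "'a set set \<Rightarrow> 'a list \<Rightarrow> bool" where
  "circuit E rs \<longleftrightarrow> length rs \<ge> 4 \<and> hd rs = last rs \<and> distinct (butlast rs) \<and>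
     (\<forall>i. Suc i < length rs \<longrightarrow> {rs ! i, rs ! Suc i} \<in> E)"

definition same_circuit :: "'a list \<Rightarrow> 'a list \<Rightarrow> bool" where
  "same_circuit p q \<longleftrightarrow>
     (\<exists>k. butlast q = rotate k (butlast p) \<or> butlast q = rotate k (rev (butlast p)))"

definition at_least_two_circuits :: "'a set set \<Rightarrow> bool" where
  "at_least_two_circuits E \<longleftrightarrow> (\<exists>p q. circuit E p \<and> circuit E q \<and> \<not> same_circuit p q)"

definition is_spanning_tree :: "'a set \<Rightarrow> 'a set set \<Rightarrow> 'a set set \<Rightarrow> bool" where
  "is_spanning_tree S E E0 \<longleftrightarrow> E0 \<subseteq> E \<and> graph_connected S E0 \<and> (\<nexists>p. circuit E0 p)"


section \<open>Coxeter groups\<close>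

text \<open>\<open>group.ord\<close> is 0 for elements of infinite order, so the value 0 stands for
  \<open>m\<^sub>s\<^sub>t = \<infinity>\<close>. Since \<open>pi / 0 = 0\<close> in HOL, this also agrees with \<open>cos (\<pi>/\<infinity>) = 1\<close>.\<close>

definition cox_m :: "('w, 'x) monoid_scheme \<Rightarrow> 'w \<Rightarrow> 'w \<Rightarrow> nat" where
  "cox_m W s t = group.ord W (s \<otimes>\<^bsub>W\<^esub> t)"

definition word_prod :: "('w, 'x) monoid_scheme \<Rightarrow> 'w list \<Rightarrow> 'w" where
  "word_prod W ws = foldr (mult W) ws \<one>\<^bsub>W\<^esub>"

text \<open>Deleting one occurrence of a relator \<open>(s t)\<^bsup>m\<^esup>\<close> from a word over \<open>S\<close>. For
  \<open>m = 0\<close> (infinite order) the relator is empty; for \<open>s = t\<close> in a Coxeter system we have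
  \<open>m = 1\<close> and the relator is \<open>s\<^sup>2\<close>, so that no inverse letters are needed.\<close>

inductive relator_step :: "('w, 'x) monoid_scheme \<Rightarrow> 'w set \<Rightarrow> 'w list \<Rightarrow> 'w list \<Rightarrow> bool"
  for W S where
  "\<lbrakk>s \<in> S; t \<in> S; xs \<in> lists S; ys \<in> lists S\<rbrakk> \<Longrightarrow>
     relator_step W S (xs @ concat (replicate (cox_m W s t) [s, t]) @ ys) (xs @ ys)"

text \<open>\<open>W\<close> is generated by the involutions in \<open>S\<close> and presented by the relations
  \<open>(s t)\<^bsup>m\<^sub>s\<^sub>t\<^esup> = 1\<close>: any two words with the same value in \<open>W\<close> are related by inserting and
  deleting relators. The set \<open>S\<close> may be infinite.\<close>

locale coxeter_system = group W for W (structure) +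
  fixes S :: "'a set"
  assumes gens_closed: "S \<subseteq> carrier W"
    and gens_involutions: "s \<in> S \<Longrightarrow> ord s = 2"
    and gens_generate: "generate W S = carrier W"
    and presentation: "\<lbrakk>xs \<in> lists S; ys \<in> lists S; word_prod W xs = word_prod W ys\<rbrakk> \<Longrightarrow>
          equivclp (relator_step W S) xs ys"

definition cox_edges :: "('w, 'x) monoid_scheme \<Rightarrow> 'w set \<Rightarrow> 'w set set" where
  "cox_edges W S = {{s, t} | s t. s \<in> S \<and> t \<in> S \<and> (cox_m W s t \<ge> 3 \<or> cox_m W s t = 0)}"


section \<open>Linear representations and their quotients\<close>

locale linear_rep = vectorspace K V + G?: group G
  for K :: "('k, 'x) ring_scheme" and V :: "('k, 'v, 'y) module_scheme"
    and G :: "('g, 'z) monoid_scheme" +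
  fixes \<rho> :: "'g \<Rightarrow> 'v \<Rightarrow> 'v"
  assumes rep_linear: "g \<in> carrier G \<Longrightarrow> \<rho> g \<in> module_hom K V V"
    and rep_one: "v \<in> carrier V \<Longrightarrow> \<rho> \<one>\<^bsub>G\<^esub> v = v"
    and rep_mult: "\<lbrakk>g \<in> carrier G; h \<in> carrier G; v \<in> carrier V\<rbrakk> \<Longrightarrow>
          \<rho> (g \<otimes>\<^bsub>G\<^esub> h) v = \<rho> g (\<rho> h v)"

definition irreducible_rep ::
  "('k, 'x) ring_scheme \<Rightarrow> ('k, 'v, 'y) module_scheme \<Rightarrow> ('g, 'z) monoid_scheme \<Rightarrow>
     ('g \<Rightarrow> 'v \<Rightarrow> 'v) \<Rightarrow> bool" where
  "irreducible_rep K V G \<rho> \<longleftrightarrow>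
     linear_rep K V G \<rho> \<and> carrier V \<noteq> {\<zero>\<^bsub>V\<^esub>} \<and>
     (\<forall>U. VectorSpace.subspace K U V \<and> (\<forall>g\<in>carrier G. \<forall>u\<in>U. \<rho> g u \<in> U) \<longrightarrow>
        U = {\<zero>\<^bsub>V\<^esub>} \<or> U = carrier V)"

text \<open>The elements of \<open>V/U\<close> are the cosets of \<open>U\<close>. A linear map \<open>f\<close> with \<open>f U \<subseteq> U\<close> induces
  \<open>v + U \<mapsto> f v + U\<close>, which is \<open>X \<mapsto> U + f X\<close> on cosets; scalar multiplication on \<open>V/U\<close> is the
  case of a homothety (adding \<open>U\<close> matters for the scalar 0). The multiplicative fields of the
  module record are irrelevant.\<close>

definition quot_map :: "('k, 'v, 'y) module_scheme \<Rightarrow> 'v set \<Rightarrow> ('v \<Rightarrow> 'v) \<Rightarrow> 'v set \<Rightarrow> 'v set" where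
  "quot_map V U f X = U <+>\<^bsub>V\<^esub> (f ` X)"

definition quot_space :: "('k, 'v, 'y) module_scheme \<Rightarrow> 'v set \<Rightarrow> ('k, 'v set) module" where
  "quot_space V U = \<lparr>
     carrier = a_rcosets\<^bsub>V\<^esub> U,
     mult = undefined,
     one = undefined,
     zero = U,
     add = set_add V,
     smult = (\<lambda>c. quot_map V U (\<lambda>v. c \<odot>\<^bsub>V\<^esub> v))\<rparr>"


section \<open>The representation \<open>V\<close>\<close>

definition cox_space :: "'w set \<Rightarrow> (complex, 'w \<times> int \<Rightarrow> complex) module" where
  "cox_space S = \<lparr>
     carrier = {f. finite {b. f b \<noteq> 0} \<and> {b. f b \<noteq> 0} \<subseteq> S \<times> UNIV},
     mult = undefined,
     one = undefined,
     zero = (\<lambda>b. 0),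
     add = (\<lambda>f g b. f b + g b),
     smult = (\<lambda>c f b. c * f b)\<rparr>"

definition \<alpha> :: "'w \<Rightarrow> int \<Rightarrow> 'w \<times> int \<Rightarrow> complex" where
  "\<alpha> s n = (\<lambda>b. if b = (s, n) then 1 else 0)"

definition cox_cos :: "('w, 'x) monoid_scheme \<Rightarrow> 'w \<Rightarrow> 'w \<Rightarrow> complex" where
  "cox_cos W s t = complex_of_real (cos (pi / real (cox_m W s t)))"

text \<open>The image of \<open>\<alpha> t n\<close> under the generator \<open>s\<close>. In the third and fifth case the formulas for
  \<open>t\<^sub>1 \<cdot> \<alpha> s\<^sub>1 (k + 1)\<close> and \<open>t\<^sub>2 \<cdot> \<alpha> s\<^sub>2 (k + 1)\<close> are written with \<open>k = n - 1\<close>.\<close>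

definition gen_on_basis ::
  "('w, 'x) monoid_scheme \<Rightarrow> 'w \<Rightarrow> 'w \<Rightarrow> 'w \<Rightarrow> 'w \<Rightarrow> 'w \<Rightarrow> 'w \<Rightarrow> int \<Rightarrow> 'w \<times> int \<Rightarrow> complex" where
  "gen_on_basis W s1 t1 s2 t2 s t n =
    (if t = s then (\<lambda>b. - \<alpha> s n b)
     else if s = s1 \<and> t = t1 then
       (\<lambda>b. \<alpha> t1 n b + 2 * cox_cos W s1 t1 * \<alpha> s1 (n + 1) b)
     else if s = t1 \<and> t = s1 then
       (\<lambda>b. \<alpha> s1 n b + 2 * cox_cos W s1 t1 * \<alpha> t1 (n - 1) b)
     else if s = s2 \<and> t = t2 then
       (\<lambda>b. \<alpha> t2 n b + 2 powi (n + 1) * cox_cos W s2 t2 * \<alpha> s2 (n + 1) b)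
     else if s = t2 \<and> t = s2 then
       (\<lambda>b. \<alpha> s2 n b + 2 powi (- (n - 1) + 1) * cox_cos W s2 t2 * \<alpha> t2 (n - 1) b)
     else
       (\<lambda>b. \<alpha> t n b + 2 * cox_cos W s t * \<alpha> s n b))"

definition gen_action ::
  "('w, 'x) monoid_scheme \<Rightarrow> 'w \<Rightarrow> 'w \<Rightarrow> 'w \<Rightarrow> 'w \<Rightarrow> 'w \<Rightarrow>
     ('w \<times> int \<Rightarrow> complex) \<Rightarrow> ('w \<times> int \<Rightarrow> complex)" where
  "gen_action W s1 t1 s2 t2 s f =
     (\<lambda>b. \<Sum>(t, n)\<in>{x. f x \<noteq> 0}. f (t, n) * gen_on_basis W s1 t1 s2 t2 s t n b)"

text \<open>An element \<open>w\<close> of \<open>W\<close> acts through any word over \<open>S\<close> representing it; the choice of the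
  word is immaterial because the generators satisfy the defining relations of \<open>W\<close> on \<open>V\<close>.\<close>

definition cox_action ::
  "('w, 'x) monoid_scheme \<Rightarrow> 'w set \<Rightarrow> 'w \<Rightarrow> 'w \<Rightarrow> 'w \<Rightarrow> 'w \<Rightarrow> 'w \<Rightarrow>
     ('w \<times> int \<Rightarrow> complex) \<Rightarrow> ('w \<times> int \<Rightarrow> complex)" where
  "cox_action W S s1 t1 s2 t2 w =
     foldr (gen_action W s1 t1 s2 t2) (SOME ws. ws \<in> lists S \<and> word_prod W ws = w)"

definition fixed_vectors ::
  "('k, 'v, 'y) module_scheme \<Rightarrow> 'g set \<Rightarrow> ('g \<Rightarrow> 'v \<Rightarrow> 'v) \<Rightarrow> 'v set" where
  "fixed_vectors V S \<rho> = {v \<in> carrier V. \<forall>s\<in>S. \<rho> s v = v}"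

end

theory Submission
  imports Defs
begin

text \<open>For a generator \<open>s\<close> the image of \<open>s - 1\<close> lies in the span \<open>V\<^sub>s\<close> of the vectors \<open>\<alpha> s n\<close>, and
  along an edge \<open>{s, t}\<close> the map \<open>s - 1\<close> is an isomorphism \<open>V\<^sub>t \<rightarrow> V\<^sub>s\<close>. Along tree edges it is a
  nonzero multiple of \<open>\<alpha> t n \<mapsto> \<alpha> s n\<close>, so all \<open>V\<^sub>s\<close> may be identified. The first extra edge then
  gives the shift \<open>\<alpha> s n \<mapsto> \<alpha> s (n + 1)\<close> and its inverse, and a loop through both extra edges gives
  the diagonal operator \<open>\<alpha> s n \<mapsto> 2 powi (- n) \<alpha> s n\<close>, whose eigenvalues are distinct. An invariant
  subspace containing a vector \<open>v\<close> with \<open>s v \<noteq> v\<close> contains the nonzero vector \<open>(s - 1) v \<in> V\<^sub>s\<close>, hence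
  some \<open>\<alpha> s n\<close>, hence all of them. The quotient is infinite dimensional because \<open>s - 1\<close> factors
  through it and maps onto \<open>V\<^sub>s\<close>.\<close>

section \<open>Quotients of linear representations\<close>

text \<open>Negation is multiplication by the scalar -1, so closure under scalars supplies the
  additive inverses. This makes the coset lemmas of \<open>abelian_subgroup\<close> available for
  submodules.\<close>

lemma (in module) abelian_subgroup_submodule:
  assumes "submodule R N M"
  shows "abelian_subgroup N M"
proof -
  interpret N: submodule R N M by fact
  have "\<ominus>\<^bsub>M\<^esub> x \<in> N" if "x \<in> N" for x
  proof -
    have "\<ominus>\<^bsub>M\<^esub> x = (\<ominus> \<one>) \<odot>\<^bsub>M\<^esub> x"
      using that N.subset by (metis R.one_closed smult_l_minus smult_one subsetD)
    then show ?thesis using that by simp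
  qed
  then have "subgroup N (add_monoid M)"
    using N.subset by (intro M.add.subgroupI) (auto intro: N.zero_closed)
  then show ?thesis
    by (intro abelian_subgroupI3 additive_subgroupI M.abelian_group_axioms)
qed

lemma (in abelian_subgroup) coset_eq_self_iff:
  assumes "v \<in> carrier G"
  shows "H +> v = H \<longleftrightarrow> v \<in> H"
  using a_rcos_const a_rcos_self[OF assms] by auto

text \<open>The image under \<open>f\<close> of an element of the coset is
  \<open>f h' \<oplus> f v\<close>, and \<open>N\<close> absorbs \<open>f h'\<close>. Only
  additivity of \<open>f\<close> enters, so one statement serves both the homotheties and the group
  action.\<close>

lemma (in module) quot_map_coset:
  assumes N: "submodule R N M" and f: "f \<in> carrier M \<rightarrow> carrier M"
    and add: "\<And>x y. x \<in> carrier M \<Longrightarrow> y \<in> carrier M \<Longrightarrow> f (x \<oplus>\<^bsub>M\<^esub> y) = f x \<oplus>\<^bsub>M\<^esub> f y"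
    and fN: "f ` N \<subseteq> N"
    and v: "v \<in> carrier M"
  shows "quot_map M N f (N +>\<^bsub>M\<^esub> v) = N +>\<^bsub>M\<^esub> f v"
proof -
  interpret N: submodule R N M by fact
  interpret abelian_subgroup N M by (rule abelian_subgroup_submodule) fact
  have fv: "f v \<in> carrier M" using f v by auto
  show ?thesis
  proof (intro equalityI subsetI)
    fix x assume "x \<in> quot_map M N f (N +>\<^bsub>M\<^esub> v)"
    then obtain h h' where h: "h \<in> N" "h' \<in> N" and x: "x = h \<oplus>\<^bsub>M\<^esub> f (h' \<oplus>\<^bsub>M\<^esub> v)"
      by (auto simp: quot_map_def set_add_def' a_r_coset_def')
    have "f h' \<in> N" using fN h by auto
    then have "x = (h \<oplus>\<^bsub>M\<^esub> f h') \<oplus>\<^bsub>M\<^esub> f v"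
      unfolding x using h v fv by (simp add: add M.a_assoc)
    then show "x \<in> N +>\<^bsub>M\<^esub> f v"
      using h \<open>f h' \<in> N\<close> by (auto simp: a_r_coset_def')
  next
    fix x assume "x \<in> N +>\<^bsub>M\<^esub> f v"
    then obtain h where h: "h \<in> N" and x: "x = h \<oplus>\<^bsub>M\<^esub> f v" by (auto simp: a_r_coset_def')
    then have "x = h \<oplus>\<^bsub>M\<^esub> f (\<zero>\<^bsub>M\<^esub> \<oplus>\<^bsub>M\<^esub> v)" using v by simp
    then show "x \<in> quot_map M N f (N +>\<^bsub>M\<^esub> v)"
      using h N.zero_closed unfolding quot_map_def set_add_def' a_r_coset_def' by blast
  qed
qed

context vectorspace
begin

lemma quot_space_simps:
  "carrier (quot_space V U) = (\<lambda>v. U +>\<^bsub>V\<^esub> v) ` carrier V"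
  "\<zero>\<^bsub>quot_space V U\<^esub> = U"
  "X \<oplus>\<^bsub>quot_space V U\<^esub> Y = X <+>\<^bsub>V\<^esub> Y"
  "c \<odot>\<^bsub>quot_space V U\<^esub> X = quot_map V U (\<lambda>v. c \<odot>\<^bsub>V\<^esub> v) X"
  by (auto simp: quot_space_def A_RCOSETS_def')

lemma quot_space_smult_coset:
  assumes "subspace K U V" "c \<in> carrier K" "v \<in> carrier V"
  shows "c \<odot>\<^bsub>quot_space V U\<^esub> (U +>\<^bsub>V\<^esub> v) = U +>\<^bsub>V\<^esub> (c \<odot>\<^bsub>V\<^esub> v)"
proof -
  interpret U: submodule K U V using assms(1) by simp
  interpret abelian_subgroup U V by (rule abelian_subgroup_submodule) (rule U.submodule_axioms)
  show ?thesis
    unfolding quot_space_simps using assms by (intro quot_map_coset) (auto simp: smult_r_distr)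
qed

lemma quot_space_add_coset:
  assumes "subspace K U V" "v \<in> carrier V" "w \<in> carrier V"
  shows "(U +>\<^bsub>V\<^esub> v) \<oplus>\<^bsub>quot_space V U\<^esub> (U +>\<^bsub>V\<^esub> w) = U +>\<^bsub>V\<^esub> (v \<oplus>\<^bsub>V\<^esub> w)"
proof -
  interpret U: submodule K U V using assms(1) by simp
  interpret abelian_subgroup U V by (rule abelian_subgroup_submodule) (rule U.submodule_axioms)
  show ?thesis
    unfolding quot_space_simps using assms by (intro a_rcos_sum)
qed

lemma quot_space_vectorspace:
  assumes U: "subspace K U V"
  shows "vectorspace K (quot_space V U)"
proof -
  interpret U: submodule K U V using assms(1) by simp
  interpret abelian_subgroup U V by (rule abelian_subgroup_submodule) (rule U.submodule_axioms)
  note [simp] = quot_space_smult_coset[OF U] quot_space_add_coset[OF U]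
  let ?Q = "quot_space V U"
  \<comment> \<open>The zero of the quotient is written as a coset so that the rule for sums of
    cosets applies to it.\<close>
  have U0: "U = U +>\<^bsub>V\<^esub> \<zero>\<^bsub>V\<^esub>"
    using a_rcos_const[OF U.zero_closed] by simp
  have "abelian_group ?Q"
  proof (intro abelian_groupI)
    show "\<zero>\<^bsub>?Q\<^esub> \<in> carrier ?Q" by (subst quot_space_simps, subst U0) (auto simp: quot_space_simps)
    fix x assume "x \<in> carrier ?Q"
    then obtain v where v: "x = U +>\<^bsub>V\<^esub> v" "v \<in> carrier V" by (auto simp: quot_space_simps(1))
    show "\<zero>\<^bsub>?Q\<^esub> \<oplus>\<^bsub>?Q\<^esub> x = x"
      by (subst quot_space_simps(2), subst U0) (use v in simp)
    show "\<exists>y\<in>carrier ?Q. y \<oplus>\<^bsub>?Q\<^esub> x = \<zero>\<^bsub>?Q\<^esub>"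
      by (subst quot_space_simps(2), subst (2) U0, intro bexI[of _ "U +>\<^bsub>V\<^esub> (\<ominus>\<^bsub>V\<^esub> v)"])
        (use v in \<open>auto simp: quot_space_simps(1) M.l_neg\<close>)
  qed (auto simp: quot_space_simps(1) M.add.m_ac)
  moreover have "module_axioms K ?Q"
    by unfold_locales
      (auto simp: quot_space_simps(1) smult_l_distr smult_r_distr smult_assoc1)
  ultimately have "module K ?Q"
    by (intro module.intro is_cring)
  then show ?thesis
    by (intro vectorspace.intro field_axioms)
qed

end

context linear_rep
begin

lemma rep_closed: "g \<in> carrier G \<Longrightarrow> v \<in> carrier V \<Longrightarrow> \<rho> g v \<in> carrier V"
  by (rule funcset_mem[OF module_hom_closed[OF rep_linear]])

lemma quot_map_rep_coset:
  assumes U: "subspace K U V" and inv: "\<And>g u. g \<in> carrier G \<Longrightarrow> u \<in> U \<Longrightarrow> \<rho> g u \<in> U"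
    and "g \<in> carrier G" "v \<in> carrier V"
  shows "quot_map V U (\<rho> g) (U +>\<^bsub>V\<^esub> v) = U +>\<^bsub>V\<^esub> \<rho> g v"
proof -
  interpret U: submodule K U V using U by simp
  interpret abelian_subgroup U V by (rule abelian_subgroup_submodule) (rule U.submodule_axioms)
  show ?thesis
    using assms rep_linear[of g] by (intro quot_map_coset) (auto simp: module_hom_def)
qed

lemma quot_rep:
  assumes U: "subspace K U V" and inv: "\<And>g u. g \<in> carrier G \<Longrightarrow> u \<in> U \<Longrightarrow> \<rho> g u \<in> U"
  shows "linear_rep K (quot_space V U) G (\<lambda>g. quot_map V U (\<rho> g))"
proof -
  interpret Q: vectorspace K "quot_space V U" by (rule quot_space_vectorspace[OF U])
  note [simp] = quot_map_rep_coset[OF U inv] quot_space_add_coset[OF U] quot_space_smult_coset[OF U]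
  show ?thesis
  proof unfold_locales
    fix g assume "g \<in> carrier G"
    then show "quot_map V U (\<rho> g) \<in> module_hom K (quot_space V U) (quot_space V U)"
      using rep_closed[of g] rep_linear[of g]
      by (auto simp: module_hom_def quot_space_simps(1))
  next
    fix X assume "X \<in> carrier (quot_space V U)"
    then show "quot_map V U (\<rho> \<one>\<^bsub>G\<^esub>) X = X"
      by (auto simp: quot_space_simps(1) rep_one)
  next
    fix g h X assume "g \<in> carrier G" "h \<in> carrier G" "X \<in> carrier (quot_space V U)"
    then show "quot_map V U (\<rho> (g \<otimes>\<^bsub>G\<^esub> h)) X = quot_map V U (\<rho> g) (quot_map V U (\<rho> h) X)"
      by (auto simp: quot_space_simps(1) rep_mult rep_closed)
  qed
qed

text \<open>Invariant subspaces of \<open>V/U\<close> correspond to invariant subspaces of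
  \<open>V\<close> that contain \<open>U\<close>, so it suffices that \<open>U\<close> is maximal
  among the proper ones.\<close>

lemma irreducible_quot_rep:
  assumes U: "subspace K U V" and inv: "\<And>g u. g \<in> carrier G \<Longrightarrow> u \<in> U \<Longrightarrow> \<rho> g u \<in> U"
    and proper: "U \<noteq> carrier V"
    and maximal: "\<And>U'. subspace K U' V \<Longrightarrow> (\<And>g u. g \<in> carrier G \<Longrightarrow> u \<in> U' \<Longrightarrow> \<rho> g u \<in> U') \<Longrightarrow>
      U \<subset> U' \<Longrightarrow> U' = carrier V"
  shows "irreducible_rep K (quot_space V U) G (\<lambda>g. quot_map V U (\<rho> g))"
  unfolding irreducible_rep_def
proof (intro conjI allI impI)
  show "linear_rep K (quot_space V U) G (\<lambda>g. quot_map V U (\<rho> g))"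
    by (rule quot_rep[OF U inv])
  interpret Q: vectorspace K "quot_space V U" by (rule quot_space_vectorspace[OF U])
  interpret U: submodule K U V using U by simp
  interpret abelian_subgroup U V by (rule abelian_subgroup_submodule) (rule U.submodule_axioms)
  note [simp] = quot_map_rep_coset[OF U inv] quot_space_add_coset[OF U] quot_space_smult_coset[OF U]
  obtain v where v: "v \<in> carrier V" "v \<notin> U" using proper U.subset by auto
  then have "U +>\<^bsub>V\<^esub> v \<noteq> U" using coset_eq_self_iff by auto
  with v show "carrier (quot_space V U) \<noteq> {\<zero>\<^bsub>quot_space V U\<^esub>}"
    by (auto simp: quot_space_simps(1,2))
  fix X assume "subspace K X (quot_space V U) \<and>
    (\<forall>g\<in>carrier G. \<forall>u\<in>X. quot_map V U (\<rho> g) u \<in> X)"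
  then have "subspace K X (quot_space V U)"
    and X_inv: "\<And>g u. g \<in> carrier G \<Longrightarrow> u \<in> X \<Longrightarrow> quot_map V U (\<rho> g) u \<in> X" by auto
  then interpret X: submodule K X "quot_space V U" by simp
  \<comment> \<open>The preimage of \<open>X\<close> under the quotient map.\<close>
  define U' where "U' = {v \<in> carrier V. U +>\<^bsub>V\<^esub> v \<in> X}"
  have X_eq: "X = (\<lambda>v. U +>\<^bsub>V\<^esub> v) ` U'"
    using X.subset by (auto simp: U'_def quot_space_simps(1))
  have UX: "U \<in> X" using X.zero_closed by (simp add: quot_space_simps)
  have "U \<subseteq> U'"
    using UX U.subset by (auto simp: U'_def a_rcos_const)
  have "\<zero>\<^bsub>V\<^esub> \<in> U'" using \<open>U \<subseteq> U'\<close> U.zero_closed by auto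
  have "submodule K U' V"
  proof unfold_locales
    fix v w assume "v \<in> U'" "w \<in> U'"
    then show "v \<oplus>\<^bsub>V\<^esub> w \<in> U'"
      using X.m_closed[of "U +>\<^bsub>V\<^esub> v" "U +>\<^bsub>V\<^esub> w"] by (auto simp: U'_def)
  next
    fix c v assume "c \<in> carrier K" "v \<in> U'"
    then show "c \<odot>\<^bsub>V\<^esub> v \<in> U'"
      using X.smult_closed[of c "U +>\<^bsub>V\<^esub> v"] by (auto simp: U'_def)
  qed (use \<open>\<zero>\<^bsub>V\<^esub> \<in> U'\<close> in \<open>auto simp: U'_def\<close>)
  then have sub: "subspace K U' V"
    by (intro subspace.intro vectorspace_axioms)
  have inv': "\<rho> g u \<in> U'" if "g \<in> carrier G" "u \<in> U'" for g u
    using X_inv[of g "U +>\<^bsub>V\<^esub> u"] that by (auto simp: U'_def rep_closed)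
  show "X = {\<zero>\<^bsub>quot_space V U\<^esub>} \<or> X = carrier (quot_space V U)"
  proof (cases "U' = U")
    case True
    have "X = {U}" unfolding X_eq True using U.zero_closed a_rcos_const by (auto intro!: image_eqI[of _ _ "\<zero>\<^bsub>V\<^esub>"])
    then show ?thesis by (simp add: quot_space_simps)
  next
    case False
    then have "U' = carrier V" using \<open>U \<subseteq> U'\<close> by (intro maximal sub inv') auto
    then show ?thesis by (auto simp: X_eq quot_space_simps(1))
  qed
qed

end

section \<open>The generators and the braid relations\<close>

text \<open>With \<open>\<theta> = 2 * pi / m\<close> every solution is a combination of shifted
  values of \<open>sin (k * \<theta>)\<close> and so has period \<open>m\<close>. Summing the
  recurrence over one period gives \<open>(c - 2)\<close> times the sum equal to 0, where
  \<open>c = 2 * cos \<theta>\<close> differs from 2. The bound \<open>m \<ge> 3\<close> places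
  \<open>\<theta>\<close> strictly between 0 and \<open>pi\<close>, so \<open>sin \<theta>\<close>
  can be cancelled.\<close>

lemma sum_period_trig_recurrence:
  fixes w :: "nat \<Rightarrow> complex"
  assumes m: "m \<ge> 3"
    and rec: "\<And>k. w (Suc (Suc k)) = 2 * cos (2 * pi / m) * w (Suc k) - w k"
  shows "(\<Sum>k<m. w k) = 0"
proof -
  define \<theta> where "\<theta> = 2 * pi / m"
  define c where "c = complex_of_real (2 * cos \<theta>)"
  have rec': "w (Suc (Suc k)) = c * w (Suc k) - w k" for k
    using rec[of k] by (simp add: c_def \<theta>_def)
  have \<theta>: "0 < \<theta>" "\<theta> < pi" using m by (auto simp: \<theta>_def field_simps)
  then have sin: "sin \<theta> \<noteq> 0" using sin_gt_zero[of \<theta>] by simp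
  have cos: "c \<noteq> 2"
  proof
    assume "c = 2"
    then have "complex_of_real (cos \<theta>) = 1" by (simp add: c_def)
    then have "cos \<theta> = 1" by (simp only: of_real_eq_1_iff)
    with \<theta> show False using cos_monotone_0_pi[of 0 \<theta>] by simp
  qed
  have step: "complex_of_real (sin ((x + 1) * \<theta>)) = c * sin (x * \<theta>) - sin ((x - 1) * \<theta>)" for x :: real
  proof -
    have "sin ((x + 1) * \<theta>) = 2 * cos \<theta> * sin (x * \<theta>) - sin ((x - 1) * \<theta>)"
      by (simp add: distrib_right left_diff_distrib sin_add sin_diff)
    then show ?thesis unfolding c_def by simp
  qed
  have ring: "c * (x * a - y * b) - (y * a - z * b) = (c * x - y) * a - (c * y - z) * b"
    for x y z a b :: complex
    by (simp add: algebra_simps)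
  \<comment> \<open>Two consecutive indices are carried along because the recurrence has order two.
    The subtraction is done in the reals, since \<open>k - 1\<close> on naturals would truncate at
    \<open>k = 0\<close>.\<close>
  have closed: "sin \<theta> * w k = sin (k * \<theta>) * w 1 - sin ((real k - 1) * \<theta>) * w 0 \<and>
      sin \<theta> * w (Suc k) = sin (Suc k * \<theta>) * w 1 - sin (k * \<theta>) * w 0" for k
  proof (induction k)
    case (Suc k)
    have "sin \<theta> * w (Suc (Suc k)) = c * (sin \<theta> * w (Suc k)) - sin \<theta> * w k"
      by (simp add: rec' algebra_simps)
    also have "\<dots> = c * (sin (Suc k * \<theta>) * w 1 - sin (k * \<theta>) * w 0)
        - (sin (k * \<theta>) * w 1 - sin ((real k - 1) * \<theta>) * w 0)"
      by (simp only: Suc)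
    also have "\<dots> = (c * sin (Suc k * \<theta>) - sin (k * \<theta>)) * w 1
        - (c * sin (k * \<theta>) - sin ((real k - 1) * \<theta>)) * w 0"
      by (rule ring)
    also have "\<dots> = sin (Suc (Suc k) * \<theta>) * w 1 - sin (Suc k * \<theta>) * w 0"
      using step[of "real k"] step[of "real (Suc k)"] by (simp add: add_ac)
    finally show ?case using Suc by simp
  qed simp
  have m\<theta>: "m * \<theta> = 2 * pi" using m by (simp add: \<theta>_def)
  have "sin ((real m - 1) * \<theta>) = - sin \<theta>" "sin (Suc m * \<theta>) = sin \<theta>"
    using m\<theta> by (simp_all add: left_diff_distrib distrib_right sin_diff sin_add)
  then have per: "w m = w 0" "w (Suc m) = w 1"
    using closed[of m] m\<theta> sin by auto
  let ?s = "\<lambda>j. \<Sum>k<m. w (k + j)"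
  \<comment> \<open>By periodicity a window of \<open>m\<close> consecutive terms has the same sum
    wherever it starts.\<close>
  have s1: "?s 1 = ?s 0" and s2: "?s 2 = ?s 1"
    using sum.lessThan_Suc_shift[of w m] sum.lessThan_Suc[of w m]
      sum.lessThan_Suc_shift[of "\<lambda>k. w (Suc k)" m] sum.lessThan_Suc[of "\<lambda>k. w (Suc k)" m] per
    by (simp_all add: numeral_2_eq_2)
  have "?s 2 = c * ?s 1 - ?s 0"
    using rec' by (simp add: sum_subtractf sum_distrib_left numeral_2_eq_2)
  then have "(c - 2) * ?s 0 = 0" unfolding s2 s1 by (simp add: algebra_simps)
  then show ?thesis using cos by simp
qed

section \<open>The vector space of finitely supported functions\<close>

lemma cox_space_carrier:
  "f \<in> carrier (cox_space S) \<longleftrightarrow> finite {b. f b \<noteq> 0} \<and> {b. f b \<noteq> 0} \<subseteq> S \<times> UNIV"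
  by (simp add: cox_space_def)

lemma cox_space_simps [simp]:
  "\<zero>\<^bsub>cox_space S\<^esub> = (\<lambda>b. 0)"
  "f \<oplus>\<^bsub>cox_space S\<^esub> g = (\<lambda>b. f b + g b)"
  "c \<odot>\<^bsub>cox_space S\<^esub> f = (\<lambda>b. c * f b)"
  by (auto simp: cox_space_def)

lemma cox_space_zero_closed: "(\<lambda>b. 0) \<in> carrier (cox_space S)"
  by (simp add: cox_space_carrier)

lemma cox_space_add_closed:
  assumes "f \<in> carrier (cox_space S)" "g \<in> carrier (cox_space S)"
  shows "(\<lambda>b. f b + g b) \<in> carrier (cox_space S)"
proof -
  have "{b. f b + g b \<noteq> 0} \<subseteq> {b. f b \<noteq> 0} \<union> {b. g b \<noteq> 0}" by auto
  with assms show ?thesis by (auto simp: cox_space_carrier intro: finite_subset)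
qed

lemma cox_space_smult_closed:
  assumes "f \<in> carrier (cox_space S)"
  shows "(\<lambda>b. c * f b) \<in> carrier (cox_space S)"
  using assms by (auto simp: cox_space_carrier intro: finite_subset[of _ "{b. f b \<noteq> 0}"])

lemma vectorspace_cox_space: "vectorspace class_ring (cox_space S)"
proof -
  have "abelian_group (cox_space S)"
  proof (rule abelian_groupI)
    fix f assume f: "f \<in> carrier (cox_space S)"
    show "\<exists>g\<in>carrier (cox_space S). g \<oplus>\<^bsub>cox_space S\<^esub> f = \<zero>\<^bsub>cox_space S\<^esub>"
      by (rule bexI[OF _ cox_space_smult_closed[OF f, of "-1"]]) simp
  qed (auto simp: algebra_simps intro: cox_space_add_closed cox_space_zero_closed)
  moreover have "module_axioms class_ring (cox_space S)"
    by unfold_locales (auto simp: algebra_simps intro: cox_space_smult_closed)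
  ultimately show ?thesis
    by (intro vectorspace.intro module.intro class_field class_cring.is_cring)
qed

locale circuit_rep = coxeter_system W S
  for W :: "('w, 'x) monoid_scheme" (structure) and S +
  fixes E0 and s1 t1 s2 t2 :: 'w
  assumes finite_gens: "finite S"
    and finite_orders: "\<lbrakk>s \<in> S; t \<in> S\<rbrakk> \<Longrightarrow> cox_m W s t \<noteq> 0"
    and spanning_tree: "is_spanning_tree S (cox_edges W S) E0"
    and edge1: "{s1, t1} \<in> cox_edges W S - E0"
    and edge2: "{s2, t2} \<in> cox_edges W S - E0"
    and edges_neq: "{s1, t1} \<noteq> {s2, t2}"
begin

abbreviation V where "V \<equiv> cox_space S"
abbreviation act where "act \<equiv> gen_action W s1 t1 s2 t2"

section \<open>Orders of products of two generators, and edges of the Coxeter graph\<close>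

lemma gens_in_carrier [simp]: "s \<in> S \<Longrightarrow> s \<in> carrier W"
  using gens_closed by auto

lemma gens_square: "s \<in> S \<Longrightarrow> s \<otimes> s = \<one>"
  using gens_involutions[of s] pow_ord_eq_1[of s] by (simp add: numeral_2_eq_2)

lemma inv_gens: "s \<in> S \<Longrightarrow> inv s = s"
  using gens_square by (simp add: inv_equality)

lemma cox_m_commute: "s \<in> S \<Longrightarrow> t \<in> S \<Longrightarrow> cox_m W s t = cox_m W t s"
  unfolding cox_m_def using ord_inv[of "s \<otimes> t"] by (simp add: inv_mult_group inv_gens)

lemma cox_m_self: "s \<in> S \<Longrightarrow> cox_m W s s = 1"
  by (simp add: cox_m_def gens_square)

lemma cox_m_ge_2:
  assumes "s \<in> S" "t \<in> S" "s \<noteq> t"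
  shows "cox_m W s t \<ge> 2"
proof -
  have "cox_m W s t \<noteq> 1"
  proof
    assume "cox_m W s t = 1"
    then have "s \<otimes> t = \<one>" using assms ord_eq_1[of "s \<otimes> t"] by (simp add: cox_m_def)
    then have "inv t = s" using assms by (intro inv_equality) auto
    then show False using assms inv_gens by auto
  qed
  with finite_orders[OF assms(1,2)] show ?thesis by linarith
qed

lemma cox_edge_iff:
  "{s, t} \<in> cox_edges W S \<longleftrightarrow> s \<in> S \<and> t \<in> S \<and> cox_m W s t \<ge> 3"
proof -
  have "cox_m W x y \<ge> 3 \<or> cox_m W x y = 0 \<longleftrightarrow> cox_m W x y \<ge> 3" if "x \<in> S" "y \<in> S" for x y
    using finite_orders[OF that] by simp
  then have "cox_edges W S = {{x, y} | x y. x \<in> S \<and> y \<in> S \<and> cox_m W x y \<ge> 3}"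
    unfolding cox_edges_def by blast
  then show ?thesis
    by (auto simp: doubleton_eq_iff cox_m_commute[of t s])
qed

lemma edge_ends:
  "s1 \<in> S" "t1 \<in> S" "s1 \<noteq> t1" "s2 \<in> S" "t2 \<in> S" "s2 \<noteq> t2"
  using edge1 edge2 cox_m_self by (auto simp: cox_edge_iff)

lemma cox_cos_commute: "s \<in> S \<Longrightarrow> t \<in> S \<Longrightarrow> cox_cos W s t = cox_cos W t s"
  by (simp add: cox_cos_def cox_m_commute)

text \<open>On an edge the label is at least 3, so the angle lies strictly between 0 and
  \<open>pi / 2\<close>. This is what makes the passage along an edge invertible.\<close>

lemma cox_cos_nonzero:
  assumes "{s, t} \<in> cox_edges W S"
  shows "cox_cos W s t \<noteq> 0"
proof -
  have "cox_m W s t \<ge> 3" using assms by (simp add: cox_edge_iff)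
  then have "cos (pi / cox_m W s t) > 0"
    by (intro cos_gt_zero) (auto simp: field_simps)
  then show ?thesis by (simp add: cox_cos_def)
qed

section \<open>Index shifts and coefficients of the generators\<close>

definition shift :: "'w \<Rightarrow> 'w \<Rightarrow> int" where
  "shift s t = (if s = s1 \<and> t = t1 \<or> s = s2 \<and> t = t2 then 1
     else if s = t1 \<and> t = s1 \<or> s = t2 \<and> t = s2 then - 1 else 0)"

text \<open>Together with \<open>shift\<close> this brings all cases of \<open>gen_on_basis\<close>
  into the single form \<open>\<alpha> t n + coef s t n * \<alpha> s (n + shift s t)\<close>. The
  value -2 on the diagonal turns \<open>\<alpha> s n\<close> into its negative, and the exponent
  \<open>2 - n\<close> is \<open>- (n - 1) + 1\<close>.\<close>

definition coef :: "'w \<Rightarrow> 'w \<Rightarrow> int \<Rightarrow> complex" where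
  "coef s t n = (if t = s then - 2
     else if s = s2 \<and> t = t2 then 2 powi (n + 1) * cox_cos W s t
     else if s = t2 \<and> t = s2 then 2 powi (2 - n) * cox_cos W s t
     else 2 * cox_cos W s t)"

text \<open>The two extra edges differ in either orientation, so the branches of
  \<open>shift\<close>, \<open>coef\<close> and \<open>gen_on_basis\<close> that belong to them do
  not overlap.\<close>

lemma edges_neq': "\<not> (s1 = s2 \<and> t1 = t2)" "\<not> (s1 = t2 \<and> t1 = s2)"
  using edges_neq by auto

lemma edge_cases:
  obtains "s = t" | "s = s1" "t = t1" | "s = t1" "t = s1" | "s = s2" "t = t2" | "s = t2" "t = s2"
  | "s \<noteq> t" "{s, t} \<noteq> {s1, t1}" "{s, t} \<noteq> {s2, t2}"
  by (metis doubleton_eq_iff)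

lemma shift_edge: "shift s1 t1 = 1" "shift t1 s1 = - 1" "shift s2 t2 = 1" "shift t2 s2 = - 1"
  using edges_neq' edge_ends unfolding shift_def by metis+

lemma shift_other: "{s, t} \<noteq> {s1, t1} \<Longrightarrow> {s, t} \<noteq> {s2, t2} \<Longrightarrow> shift s t = 0"
  unfolding shift_def doubleton_eq_iff by metis

lemma coef_edge:
  "coef s1 t1 n = 2 * cox_cos W s1 t1" "coef t1 s1 n = 2 * cox_cos W t1 s1"
  "coef s2 t2 n = 2 powi (n + 1) * cox_cos W s2 t2" "coef t2 s2 n = 2 powi (2 - n) * cox_cos W t2 s2"
  using edges_neq' edge_ends unfolding coef_def by metis+

lemma coef_other:
  "s \<noteq> t \<Longrightarrow> {s, t} \<noteq> {s2, t2} \<Longrightarrow> coef s t n = 2 * cox_cos W s t"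
  unfolding coef_def doubleton_eq_iff by metis

lemma shift_self [simp]: "shift s s = 0"
  using edge_ends by (auto simp: shift_def)

lemma shift_commute: "shift s t = - shift t s"
  by (cases s t rule: edge_cases) (simp_all add: shift_edge shift_other insert_commute)

lemma coef_self [simp]: "coef s s n = - 2"
  by (simp add: coef_def)

lemma coef_eq_0_iff: "s \<noteq> t \<Longrightarrow> coef s t n = 0 \<longleftrightarrow> cox_cos W s t = 0"
  by (cases s t rule: edge_cases) (simp_all add: coef_edge coef_other)

text \<open>The powers of 2 in the two directions of the second edge multiply to 4 for every
  \<open>n\<close>. The product is thus the one of the usual geometric representation, and the twist
  does not disturb the braid relations.\<close>

lemma coef_mult_coef:
  assumes "s \<in> S" "t \<in> S" "s \<noteq> t"
  shows "coef s t n * coef t s (n + shift s t) = 4 * (cox_cos W s t)\<^sup>2"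
proof -
  have "2 powi (n + 1) * 2 powi (1 - n) = (4::complex)"
    "2 powi (n + 1) * 2 powi (2 - (n + 1)) = (4::complex)"
    "2 powi (2 - n) * 2 powi (n - 1 + 1) = (4::complex)"
    by (simp_all flip: power_int_add)
  then show ?thesis
    using assms cox_cos_commute[OF assms(1,2)]
    by (cases s t rule: edge_cases)
      (simp_all add: coef_edge coef_other shift_edge shift_other power2_eq_square insert_commute)
qed

section \<open>The action of a generator in coordinates\<close>

lemma gen_on_basis_eq:
  assumes "s \<in> S" "t \<in> S"
  shows "gen_on_basis W s1 t1 s2 t2 s t n =
    (\<lambda>b. \<alpha> t n b + coef s t n * \<alpha> s (n + shift s t) b)"
proof (cases s t rule: edge_cases)
  case 3
  then show ?thesis
    using edges_neq' edge_ends cox_cos_commute[OF assms]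
    by (simp add: gen_on_basis_def coef_edge shift_edge)
next
  case 4
  then have "(s = s1 \<and> t = t1) = False" "(s = t1 \<and> t = s1) = False" "(t = s) = False"
    "(s = s2 \<and> t = t2) = True"
    using edges_neq' edge_ends by auto
  then have "gen_on_basis W s1 t1 s2 t2 s t n =
      (\<lambda>b. \<alpha> t2 n b + 2 powi (n + 1) * cox_cos W s2 t2 * \<alpha> s2 (n + 1) b)"
    by (simp only: gen_on_basis_def if_True if_False 4)
  then show ?thesis by (simp only: 4 coef_edge shift_edge)
next
  case 5
  then have "(s = s1 \<and> t = t1) = False" "(s = t1 \<and> t = s1) = False" "(t = s) = False"
    "(s = s2 \<and> t = t2) = False" "(s = t2 \<and> t = s2) = True"
    using edges_neq' edge_ends by auto
  then have "gen_on_basis W s1 t1 s2 t2 s t n =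
      (\<lambda>b. \<alpha> s2 n b + 2 powi (- (n - 1) + 1) * cox_cos W s2 t2 * \<alpha> t2 (n - 1) b)"
    by (simp only: gen_on_basis_def if_True if_False 5)
  moreover have "- (n - 1) + 1 = 2 - n" "n + - 1 = n - 1" by auto
  ultimately show ?thesis
    using cox_cos_commute[OF assms] by (simp only: 5 coef_edge shift_edge)
next
  case 6
  then have "(s = s1 \<and> t = t1) = False" "(s = t1 \<and> t = s1) = False" "(t = s) = False"
    "(s = s2 \<and> t = t2) = False" "(s = t2 \<and> t = s2) = False"
    by auto
  with 6 show ?thesis
    by (simp only: gen_on_basis_def if_False coef_other shift_other not_False_eq_True add_0_right)
qed (use edge_ends in \<open>simp_all add: gen_on_basis_def coef_edge shift_edge\<close>)

text \<open>The coefficient of \<open>\<alpha> s m\<close> in \<open>(s - 1) f\<close>: a vector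
  \<open>\<alpha> t n\<close> contributes exactly if \<open>n + shift s t = m\<close>. Summing over
  \<open>S\<close> instead of the support of \<open>f\<close> makes linearity in \<open>f\<close>
  immediate.\<close>

definition refl_coord :: "'w \<Rightarrow> int \<Rightarrow> ('w \<times> int \<Rightarrow> complex) \<Rightarrow> complex" where
  "refl_coord s m f = (\<Sum>t\<in>S. coef s t (m - shift s t) * f (t, m - shift s t))"

lemma act_apply:
  assumes s: "s \<in> S" and f: "f \<in> carrier V"
  shows "act s f (r, m) = f (r, m) + (if r = s then refl_coord s m f else 0)"
proof -
  let ?F = "{x. f x \<noteq> 0}"
  have F: "finite ?F" "\<And>t n. f (t, n) \<noteq> 0 \<Longrightarrow> t \<in> S"
    using f by (auto simp: cox_space_carrier)
  have "act s f (r, m) = (\<Sum>x\<in>?F. f x * \<alpha> (fst x) (snd x) (r, m)) +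
      (\<Sum>x\<in>?F. f x * coef s (fst x) (snd x) * \<alpha> s (snd x + shift s (fst x)) (r, m))"
    unfolding gen_action_def sum.distrib[symmetric]
    by (intro sum.cong) (auto simp: gen_on_basis_eq s F(2) algebra_simps)
  also have "(\<Sum>x\<in>?F. f x * \<alpha> (fst x) (snd x) (r, m)) = (\<Sum>x\<in>?F. if x = (r, m) then f x else 0)"
    by (intro sum.cong) (auto simp: \<alpha>_def)
  also have "\<dots> = f (r, m)" using F by (simp add: sum.delta')
  also have "(\<Sum>x\<in>?F. f x * coef s (fst x) (snd x) * \<alpha> s (snd x + shift s (fst x)) (r, m)) =
      (if r = s then refl_coord s m f else 0)"
  proof (cases "r = s")
    case True
    \<comment> \<open>The sum over the support is first cut down to the pairs that hit
      \<open>\<alpha> s m\<close>, then padded with zeros to one pair for each \<open>t\<close> in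
      \<open>S\<close>.\<close>
    have "(\<Sum>x\<in>?F. f x * coef s (fst x) (snd x) * \<alpha> s (snd x + shift s (fst x)) (r, m)) =
        (\<Sum>x\<in>?F \<inter> (\<lambda>t. (t, m - shift s t)) ` S. coef s (fst x) (snd x) * f x)"
      using F True by (intro sum.mono_neutral_cong_right) (auto simp: \<alpha>_def)
    also have "\<dots> = (\<Sum>x\<in>(\<lambda>t. (t, m - shift s t)) ` S. coef s (fst x) (snd x) * f x)"
      using finite_gens by (intro sum.mono_neutral_left) auto
    also have "\<dots> = refl_coord s m f"
      by (subst sum.reindex) (auto simp: inj_on_def refl_coord_def)
    finally show ?thesis using True by simp
  qed (simp add: \<alpha>_def)
  finally show ?thesis .
qed

lemma refl_coord_nonzero:
  assumes "refl_coord s m f \<noteq> 0"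
  obtains t where "t \<in> S" "f (t, m - shift s t) \<noteq> 0"
  using assms unfolding refl_coord_def by (metis (no_types, lifting) mult_eq_0_iff sum.neutral)

text \<open>Each point \<open>(t, n)\<close> of the support of \<open>f\<close> contributes only at
  the index \<open>n + shift s t\<close>.\<close>

lemma finite_refl_coord:
  assumes "f \<in> carrier V"
  shows "finite {m. refl_coord s m f \<noteq> 0}"
proof (rule finite_subset)
  show "{m. refl_coord s m f \<noteq> 0} \<subseteq> (\<lambda>(t, n). n + shift s t) ` {x. f x \<noteq> 0}"
    by (force elim: refl_coord_nonzero)
qed (use assms in \<open>simp add: cox_space_carrier\<close>)

lemma act_closed:
  assumes "s \<in> S" "f \<in> carrier V"
  shows "act s f \<in> carrier V"
proof -
  have "{x. act s f x \<noteq> 0} \<subseteq> {x. f x \<noteq> 0} \<union> Pair s ` {m. refl_coord s m f \<noteq> 0}"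
    using act_apply[OF assms] by (auto split: if_splits)
  moreover have "finite ({x. f x \<noteq> 0} \<union> Pair s ` {m. refl_coord s m f \<noteq> 0})"
    using assms finite_refl_coord by (auto simp: cox_space_carrier)
  ultimately show ?thesis
    using assms by (auto simp: cox_space_carrier intro: finite_subset)
qed

lemma refl_coord_add: "refl_coord s m (\<lambda>b. f b + g b) = refl_coord s m f + refl_coord s m g"
  by (simp add: refl_coord_def algebra_simps sum.distrib)

lemma refl_coord_smult: "refl_coord s m (\<lambda>b. c * f b) = c * refl_coord s m f"
  by (simp add: refl_coord_def sum_distrib_left algebra_simps)

lemma act_add:
  assumes "s \<in> S" "f \<in> carrier V" "g \<in> carrier V"
  shows "act s (\<lambda>b. f b + g b) = (\<lambda>b. act s f b + act s g b)"
  using assms cox_space_add_closed[OF assms(2,3)]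
  by (auto simp: fun_eq_iff act_apply refl_coord_add)

lemma act_smult:
  assumes "s \<in> S" "f \<in> carrier V"
  shows "act s (\<lambda>b. c * f b) = (\<lambda>b. c * act s f b)"
  using assms cox_space_smult_closed[OF assms(2)]
  by (auto simp: fun_eq_iff act_apply refl_coord_smult algebra_simps)

text \<open>The action of \<open>t\<close> changes only the coordinates at \<open>t\<close>, hence a
  single summand. For \<open>s = t\<close> the coefficient -2 reverses the sign of the coordinate,
  which makes each generator an involution.\<close>

lemma refl_coord_act:
  assumes "t \<in> S" "f \<in> carrier V"
  shows "refl_coord s m (act t f) = refl_coord s m f +
    coef s t (m - shift s t) * refl_coord t (m - shift s t) f"
proof -
  have "refl_coord s m (act t f) = refl_coord s m f + (\<Sum>r\<in>S. if r = t
      then coef s r (m - shift s r) * refl_coord t (m - shift s r) f else 0)"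
    unfolding refl_coord_def[of s] sum.distrib[symmetric]
    using assms by (intro sum.cong) (auto simp: act_apply distrib_left)
  then show ?thesis using assms finite_gens by simp
qed

lemma act_act:
  assumes "s \<in> S" "f \<in> carrier V"
  shows "act s (act s f) = f"
  using assms act_closed[OF assms]
  by (auto simp: fun_eq_iff act_apply refl_coord_act)

section \<open>The braid relations\<close>

lemma four_cox_cos_square: "4 * (cox_cos W s t)\<^sup>2 - 2 = complex_of_real (2 * cos (2 * pi / cox_m W s t))"
  using cos_double_cos[of "pi / cox_m W s t"] by (simp add: cox_cos_def)

text \<open>On each plane spanned by \<open>\<alpha> s (n + shift s t)\<close> and \<open>\<alpha> t n\<close> the product \<open>s t\<close> has determinant 1
  and, by \<open>coef_mult_coef\<close>, trace \<open>4 cos\<^sup>2 (\<pi>/m) - 2 = 2 cos (2\<pi>/m)\<close>. Hence the coordinates along an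
  orbit of \<open>s t\<close> obey a trigonometric recurrence, and the increments over one period cancel.\<close>

lemma braid_sum:
  assumes "s \<in> S" "t \<in> S" "s \<noteq> t"
    and A: "\<And>k. A (Suc k) = - A k - coef s t n * B k"
    and B: "\<And>k. B (Suc k) = coef t s (n + shift s t) * A k + (4 * (cox_cos W s t)\<^sup>2 - 1) * B k"
  shows "(\<Sum>k<cox_m W s t. A k) = 0" "(\<Sum>k<cox_m W s t. B k) = 0"
proof -
  let ?c = "4 * (cox_cos W s t)\<^sup>2"
  have prod: "coef s t n * coef t s (n + shift s t) = ?c" by (rule coef_mult_coef) fact+
  have recA: "A (Suc (Suc k)) = (?c - 2) * A (Suc k) - A k" for k
    unfolding A[of "Suc k"] B A[of k] prod[symmetric] by (simp add: algebra_simps)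
  have recB: "B (Suc (Suc k)) = (?c - 2) * B (Suc k) - B k" for k
    unfolding B[of "Suc k"] A B[of k] prod[symmetric] by (simp add: algebra_simps)
  show "(\<Sum>k<cox_m W s t. A k) = 0" "(\<Sum>k<cox_m W s t. B k) = 0"
  proof (atomize (full), cases "cox_m W s t = 2")
    \<comment> \<open>For \<open>m = 2\<close> both off-diagonal coefficients vanish, so
      \<open>A\<close> and \<open>B\<close> merely change sign at each step and two consecutive
      terms cancel.\<close>
    case True
    then have "cox_cos W s t = 0" "cox_cos W t s = 0"
      using assms by (simp_all add: cox_cos_def cox_m_commute[of t s])
    then have "coef s t n = 0" "coef t s (n + shift s t) = 0" "?c = 0"
      using assms by (simp_all add: coef_eq_0_iff)
    then show "(\<Sum>k<cox_m W s t. A k) = 0 \<and> (\<Sum>k<cox_m W s t. B k) = 0"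
      using A[of 0] B[of 0] True by (simp add: numeral_2_eq_2)
  next
    case False
    then have m: "cox_m W s t \<ge> 3" using cox_m_ge_2[OF assms(1-3)] by linarith
    show "(\<Sum>k<cox_m W s t. A k) = 0 \<and> (\<Sum>k<cox_m W s t. B k) = 0"
      using recA recB
      by (intro conjI sum_period_trig_recurrence[OF m]) (simp_all add: four_cox_cos_square)
  qed
qed

text \<open>With \<open>u k\<close> the image of \<open>f\<close> under the \<open>k\<close>-th
  power of \<open>s t\<close>, the difference \<open>u m - f\<close> telescopes. Each increment
  lives at \<open>s\<close> and \<open>t\<close> and is a combination of two coordinates whose sums
  over a period vanish by \<open>braid_sum\<close>.\<close>

lemma braid_relation:
  assumes st: "s \<in> S" "t \<in> S" and f: "f \<in> carrier V"
  shows "((\<lambda>g. act s (act t g)) ^^ cox_m W s t) f = f"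
proof (cases "s = t")
  case True
  then show ?thesis using act_act st f by (simp add: cox_m_self)
next
  case False
  define u where "u k = ((\<lambda>g. act s (act t g)) ^^ k) f" for k
  have u: "u k \<in> carrier V" for k
    by (induction k) (use st f in \<open>auto simp: u_def act_closed\<close>)
  have u_Suc: "u (Suc k) = act s (act t (u k))" for k by (simp add: u_def)
  note [simp] = act_apply refl_coord_act act_closed u st
  have vanish: "(\<Sum>k<cox_m W s t. refl_coord s (n + shift s t) (u k)) = 0"
    "(\<Sum>k<cox_m W s t. refl_coord t n (u k)) = 0" for n
  proof -
    have c: "coef s t n * coef t s (n + shift s t) = 4 * (cox_cos W s t)\<^sup>2"
      using st False by (intro coef_mult_coef)
    have ts: "n - shift t s = n + shift s t" using shift_commute[of s t] by simp
    have A: "refl_coord s (n + shift s t) (u (Suc k)) =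
        - refl_coord s (n + shift s t) (u k) - coef s t n * refl_coord t n (u k)" for k
      by (simp add: u_Suc)
    have B: "refl_coord t n (u (Suc k)) =
        coef t s (n + shift s t) * refl_coord s (n + shift s t) (u k)
        + (4 * (cox_cos W s t)\<^sup>2 - 1) * refl_coord t n (u k)" for k
      by (simp add: u_Suc ts c[symmetric] algebra_simps)
    show "(\<Sum>k<cox_m W s t. refl_coord s (n + shift s t) (u k)) = 0"
      "(\<Sum>k<cox_m W s t. refl_coord t n (u k)) = 0"
      using braid_sum[OF st False, where n = n and
        A = "\<lambda>k. refl_coord s (n + shift s t) (u k)" and B = "\<lambda>k. refl_coord t n (u k)"] A B
      by blast+
  qed
  have telescope: "u m (r, j) = f (r, j) + (\<Sum>k<m. u (Suc k) (r, j) - u k (r, j))" for m r j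
    using sum_lessThan_telescope[of "\<lambda>k. u k (r, j)" m] by (simp add: u_def)
  have "u (cox_m W s t) (r, j) = f (r, j)" for r j
  proof -
    have "(\<Sum>k<cox_m W s t. u (Suc k) (r, j) - u k (r, j)) = 0"
    proof -
      consider "r = s" | "r = t" "r \<noteq> s" | "r \<noteq> s" "r \<noteq> t" by blast
      then show ?thesis
      proof cases
        case 1
        \<comment> \<open>The index at \<open>t\<close> that is coupled with \<open>j\<close> at
          \<open>s\<close>: the plane in question is spanned by \<open>\<alpha> s j\<close> and
          \<open>\<alpha> t n\<close>.\<close>
        define n where "n = j - shift s t"
        have j: "j = n + shift s t" by (simp add: n_def)
        show ?thesis using 1 False vanish[of n]
          by (simp add: u_Suc j sum.distrib flip: sum_distrib_left)
      next
        case 2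
        then show ?thesis using vanish[of j] by (simp add: u_Suc)
      next
        case 3
        then show ?thesis by (simp add: u_Suc)
      qed
    qed
    then show ?thesis using telescope[of "cox_m W s t" r j] by simp
  qed
  then show ?thesis by (auto simp: u_def fun_eq_iff)
qed

section \<open>The representation of the group\<close>

abbreviation \<rho> where "\<rho> \<equiv> cox_action W S s1 t1 s2 t2"
abbreviation V0 where "V0 \<equiv> fixed_vectors V S \<rho>"

lemma foldr_act_closed:
  assumes "ws \<in> lists S" "f \<in> carrier V"
  shows "foldr act ws f \<in> carrier V"
  using assms(1) by induction (auto simp: assms(2) act_closed)

lemma foldr_act_add:
  assumes "ws \<in> lists S" "f \<in> carrier V" "g \<in> carrier V"
  shows "foldr act ws (\<lambda>b. f b + g b) = (\<lambda>b. foldr act ws f b + foldr act ws g b)"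
  using assms(1) by induction (auto simp: assms(2,3) act_add foldr_act_closed)

lemma foldr_act_smult:
  assumes "ws \<in> lists S" "f \<in> carrier V"
  shows "foldr act ws (\<lambda>b. c * f b) = (\<lambda>b. c * foldr act ws f b)"
  using assms(1) by induction (auto simp: assms(2) act_smult foldr_act_closed)

lemma foldr_act_replicate:
  "foldr act (concat (replicate m [s, t])) f = ((\<lambda>g. act s (act t g)) ^^ m) f"
  by (induction m) auto

lemma foldr_act_relator_step:
  assumes "relator_step W S xs ys" "f \<in> carrier V"
  shows "foldr act xs f = foldr act ys f"
  using assms(1)
proof cases
  case (1 s t us vs)
  then show ?thesis
    using assms(2) by (simp add: foldr_act_replicate braid_relation foldr_act_closed)
qed

text \<open>By the presentation the two words are joined by insertions and deletions of relators,
  and each of these preserves the action by the braid relations.\<close>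

lemma foldr_act_cong:
  assumes "xs \<in> lists S" "ys \<in> lists S" "word_prod W xs = word_prod W ys" "f \<in> carrier V"
  shows "foldr act xs f = foldr act ys f"
proof -
  have "equivclp (relator_step W S) xs ys" by (rule presentation) fact+
  then show ?thesis
    by induction (auto dest: foldr_act_relator_step[OF _ assms(4)])
qed

lemma word_prod_closed: "ws \<in> lists S \<Longrightarrow> word_prod W ws \<in> carrier W"
  by (induction ws rule: lists.induct) (auto simp: word_prod_def)

lemma word_prod_append:
  assumes "xs \<in> lists S" "ys \<in> lists S"
  shows "word_prod W (xs @ ys) = word_prod W xs \<otimes> word_prod W ys"
  using assms(1)
proof induction
  case (Cons x xs)
  then show ?case
    using word_prod_closed[OF assms(2)] word_prod_closed[of xs] m_assoc by (simp add: word_prod_def)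
qed (use word_prod_closed[OF assms(2)] in \<open>simp add: word_prod_def\<close>)

text \<open>Words without inverse letters suffice because every generator is its own
  inverse.\<close>

lemma word_exists:
  assumes "g \<in> carrier W"
  obtains ws where "ws \<in> lists S" "word_prod W ws = g"
proof -
  have "g \<in> generate W S" using assms gens_generate by simp
  then have "\<exists>ws\<in>lists S. word_prod W ws = g"
  proof induction
    case one
    show ?case by (rule bexI[of _ "[]"]) (auto simp: word_prod_def)
  next
    case (incl s)
    then show ?case by (intro bexI[of _ "[s]"]) (auto simp: word_prod_def)
  next
    case (inv s)
    then show ?case by (intro bexI[of _ "[s]"]) (auto simp: word_prod_def inv_gens)
  next
    case (eng g h)
    then obtain xs ys where "xs \<in> lists S" "word_prod W xs = g" "ys \<in> lists S" "word_prod W ys = h"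
      by blast
    then show ?case by (intro bexI[of _ "xs @ ys"]) (auto simp: word_prod_append)
  qed
  then show thesis using that by blast
qed

text \<open>The word picked by \<open>SOME\<close> in \<open>cox_action\<close> has the same value
  as \<open>ws\<close>, so it acts in the same way.\<close>

lemma action_word:
  assumes "ws \<in> lists S" "f \<in> carrier V"
  shows "\<rho> (word_prod W ws) f = foldr act ws f"
proof -
  let ?ws = "SOME ws'. ws' \<in> lists S \<and> word_prod W ws' = word_prod W ws"
  have "?ws \<in> lists S \<and> word_prod W ?ws = word_prod W ws"
    by (rule someI[of _ ws]) (simp add: assms)
  then show ?thesis
    unfolding cox_action_def using assms by (intro foldr_act_cong) auto
qed

lemma action_gen:
  assumes "s \<in> S" "f \<in> carrier V"
  shows "\<rho> s f = act s f"
  using action_word[of "[s]" f] assms by (simp add: word_prod_def)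

lemma linear_rep_action: "linear_rep class_ring V W \<rho>"
proof (intro linear_rep.intro vectorspace_cox_space group_axioms linear_rep_axioms.intro)
  fix g assume "g \<in> carrier W"
  then obtain ws where ws: "ws \<in> lists S" "word_prod W ws = g" by (rule word_exists)
  then have "\<rho> g f = foldr act ws f" if "f \<in> carrier V" for f
    using action_word that by blast
  then show "\<rho> g \<in> LinearCombinations.module_hom class_ring V V"
    using ws(1) by (auto simp: module_hom_def cox_space_add_closed cox_space_smult_closed
        foldr_act_closed foldr_act_add foldr_act_smult simp del: in_lists_conv_set)
next
  fix f assume "f \<in> carrier V"
  then show "\<rho> \<one> f = f" using action_word[of "[]" f] by (simp add: word_prod_def)
next
  fix g h f assume "g \<in> carrier W" "h \<in> carrier W" and f: "f \<in> carrier V"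
  then obtain xs ys where ws: "xs \<in> lists S" "word_prod W xs = g" "ys \<in> lists S" "word_prod W ys = h"
    by (meson word_exists)
  then show "\<rho> (g \<otimes> h) f = \<rho> g (\<rho> h f)"
    using f action_word[of "xs @ ys" f] action_word[OF ws(3) f]
      action_word[OF ws(1) foldr_act_closed[OF ws(3) f]]
    by (simp add: word_prod_append)
qed

sublocale rep: linear_rep class_ring V W \<rho>
  by (rule linear_rep_action)

section \<open>The fixed vectors\<close>

lemma fixed_iff: "f \<in> V0 \<longleftrightarrow> f \<in> carrier V \<and> (\<forall>s\<in>S. \<forall>m. refl_coord s m f = 0)"
proof -
  have "act s f = f \<longleftrightarrow> (\<forall>m. refl_coord s m f = 0)" if "s \<in> S" "f \<in> carrier V" for s
  proof -
    have "act s f = f \<longleftrightarrow> (\<forall>r m. r = s \<longrightarrow> refl_coord s m f = 0)"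
      using act_apply[OF that] by (simp add: fun_eq_iff)
    then show ?thesis by simp
  qed
  then show ?thesis by (auto simp: fixed_vectors_def action_gen)
qed

lemma refl_coord_zero: "refl_coord s m (\<lambda>b. 0) = 0"
  by (simp add: refl_coord_def)

text \<open>By \<open>fixed_iff\<close>, \<open>V0\<close> is the common kernel of the linear
  functionals \<open>refl_coord s m\<close>.\<close>

lemma subspace_fixed: "VectorSpace.subspace class_ring V0 V"
  by (intro VectorSpace.subspace.intro vectorspace_cox_space submodule.intro rep.module_axioms)
    (auto simp: fixed_iff refl_coord_zero refl_coord_add refl_coord_smult
      intro: cox_space_zero_closed cox_space_add_closed cox_space_smult_closed)

lemma fixed_action:
  assumes "g \<in> carrier W" "f \<in> V0"
  shows "\<rho> g f = f"
proof -
  obtain ws where ws: "ws \<in> lists S" "word_prod W ws = g" using assms(1) by (rule word_exists)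
  have f: "f \<in> carrier V" using assms(2) by (simp add: fixed_iff)
  have "foldr act ws f = f"
    using ws(1) by induction (use assms(2) f in \<open>auto simp: fixed_vectors_def action_gen\<close>)
  then show ?thesis using action_word[OF ws(1) f] ws(2) by simp
qed

lemma refl_coord_\<alpha>:
  assumes "s \<in> S" "t \<in> S"
  shows "refl_coord s m (\<alpha> t n) = (if m = n + shift s t then coef s t n else 0)"
proof -
  have "refl_coord s m (\<alpha> t n) =
      (\<Sum>r\<in>S. if r = t then (if m = n + shift s t then coef s t n else 0) else 0)"
    unfolding refl_coord_def by (intro sum.cong) (auto simp: \<alpha>_def)
  then show ?thesis using assms finite_gens by simp
qed

lemma \<alpha>_closed: "t \<in> S \<Longrightarrow> \<alpha> t n \<in> carrier V"
  by (simp add: cox_space_carrier \<alpha>_def)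

text \<open>The functional \<open>refl_coord t n\<close> takes the value -2 on
  \<open>\<alpha> t n\<close>.\<close>

lemma \<alpha>_not_fixed: "t \<in> S \<Longrightarrow> \<alpha> t n \<notin> V0"
  by (auto simp: fixed_iff refl_coord_\<alpha> intro!: bexI[of _ t] exI[of _ n])

end

text \<open>The vector of \<open>V\<^sub>t\<close> with coefficient sequence \<open>c\<close>.
  Keeping \<open>c\<close> while changing \<open>t\<close> realises the identification of the spaces
  \<open>V\<^sub>t\<close>.\<close>

definition emb :: "'w \<Rightarrow> (int \<Rightarrow> complex) \<Rightarrow> 'w \<times> int \<Rightarrow> complex" where
  "emb t c = (\<lambda>(r, n). if r = t then c n else 0)"

text \<open>Used to separate the eigenvalues of the diagonal operator in
  \<open>emb_scale\<close>.\<close>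

lemma powi_2_inj: "(2::complex) powi m = 2 powi n \<longleftrightarrow> m = n"
proof -
  have "(2::complex) powi k = complex_of_real (2 powi k)" for k
    by (simp add: of_real_power_int)
  moreover have "m = n" if "(2::real) powi m = 2 powi n"
    using that power_int_strict_increasing[of m n "2::real"] power_int_strict_increasing[of n m "2::real"]
    by (metis less_irrefl linorder_neqE one_less_numeral_iff semiring_norm(76))
  ultimately show ?thesis by (metis of_real_eq_iff)
qed

section \<open>Invariant subspaces\<close>

text \<open>An invariant subspace, with the vector operations written pointwise and invariance asked
  for the generators only.\<close>

locale circuit_subrep = circuit_rep W S E0 s1 t1 s2 t2
  for W :: "('w, 'x) monoid_scheme" (structure) and S E0 s1 t1 s2 t2 +
  fixes U
  assumes subset: "U \<subseteq> carrier V"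
    and zero_mem: "(\<lambda>b. 0) \<in> U"
    and add_mem: "f \<in> U \<Longrightarrow> g \<in> U \<Longrightarrow> (\<lambda>b. f b + g b) \<in> U"
    and smult_mem: "f \<in> U \<Longrightarrow> (\<lambda>b. c * f b) \<in> U"
    and act_mem: "s \<in> S \<Longrightarrow> f \<in> U \<Longrightarrow> act s f \<in> U"
begin

section \<open>Transport of coefficient sequences along edges\<close>

lemma emb_refl_mem:
  assumes "s \<in> S" "f \<in> U"
  shows "emb s (\<lambda>m. refl_coord s m f) \<in> U"
proof -
  have "emb s (\<lambda>m. refl_coord s m f) = (\<lambda>b. act s f b + (-1) * f b)"
    using assms subset by (auto simp: emb_def fun_eq_iff act_apply)
  then show ?thesis
    using add_mem[OF act_mem[OF assms] smult_mem[OF assms(2), of "-1"]] by simp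
qed

text \<open>This is the map \<open>s - 1\<close> from \<open>V\<^sub>t\<close> to
  \<open>V\<^sub>s\<close>, read on coefficient sequences.\<close>

lemma emb_transfer:
  assumes "s \<in> S" "t \<in> S" "emb t c \<in> U"
  shows "emb s (\<lambda>m. coef s t (m - shift s t) * c (m - shift s t)) \<in> U"
proof -
  have "refl_coord s m (emb t c) = coef s t (m - shift s t) * c (m - shift s t)" for m
  proof -
    have "refl_coord s m (emb t c) =
        (\<Sum>r\<in>S. if r = t then coef s t (m - shift s t) * c (m - shift s t) else 0)"
      unfolding refl_coord_def by (intro sum.cong) (auto simp: emb_def)
    then show ?thesis using assms finite_gens by simp
  qed
  then show ?thesis using emb_refl_mem[OF assms(1,3)] by simp
qed

lemma emb_smult_iff:
  assumes "a \<noteq> 0"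
  shows "emb t (\<lambda>m. a * c m) \<in> U \<longleftrightarrow> emb t c \<in> U"
proof -
  have smult: "emb t (\<lambda>m. x * d m) \<in> U" if "emb t d \<in> U" for x d
  proof -
    have "emb t (\<lambda>m. x * d m) = (\<lambda>b. x * emb t d b)" by (auto simp: emb_def)
    then show ?thesis using smult_mem[OF that] by simp
  qed
  show ?thesis
    using smult[of "\<lambda>m. a * c m" "inverse a"] smult[of c a] assms by (auto simp: field_simps)
qed

text \<open>Both extra edges lie outside \<open>E0\<close>, so a tree edge has no shift and its
  coefficient is a nonzero constant, which can be divided out.\<close>

lemma emb_tree_edge:
  assumes "{s, t} \<in> E0" "emb t c \<in> U"
  shows "emb s c \<in> U"
proof -
  have e: "{s, t} \<in> cox_edges W S" using assms spanning_tree by (auto simp: is_spanning_tree_def)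
  then have st: "s \<in> S" "t \<in> S" "s \<noteq> t" using cox_m_self by (auto simp: cox_edge_iff)
  have ne: "{s, t} \<noteq> {s1, t1}" "{s, t} \<noteq> {s2, t2}" using assms edge1 edge2 by auto
  show ?thesis
    using emb_transfer[OF st(1,2) assms(2)] emb_smult_iff[of "2 * cox_cos W s t" s c]
      cox_cos_nonzero[OF e]
    by (simp add: coef_other[OF st(3) ne(2)] shift_other[OF ne])
qed

lemma emb_tree:
  assumes "s \<in> S" "t \<in> S" "emb t c \<in> U"
  shows "emb s c \<in> U"
proof -
  have "(s, t) \<in> {(u, v). {u, v} \<in> E0}\<^sup>*"
    using spanning_tree assms(1,2) by (auto simp: is_spanning_tree_def graph_connected_def)
  then show ?thesis
    by (induction rule: converse_rtrancl_induct) (use assms(3) emb_tree_edge in auto)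
qed

lemma cox_cos_edges:
  "cox_cos W s1 t1 \<noteq> 0" "cox_cos W t1 s1 \<noteq> 0" "cox_cos W t2 s2 \<noteq> 0"
  using cox_cos_nonzero edge1 edge2 by (auto simp: insert_commute)

text \<open>Go to \<open>t1\<close> through the tree, cross the first extra edge to
  \<open>s1\<close>, and return through the tree. Crossing in the opposite direction gives the
  inverse shift below.\<close>

lemma emb_shift_up:
  assumes "s \<in> S" "emb s c \<in> U"
  shows "emb s (\<lambda>m. c (m - 1)) \<in> U"
proof -
  have "emb t1 c \<in> U" using assms edge_ends emb_tree by blast
  then have "emb s1 (\<lambda>m. c (m - 1)) \<in> U"
    using emb_transfer[of s1 t1 c] edge_ends cox_cos_edges emb_smult_iff[of "2 * cox_cos W s1 t1"]
    by (simp add: coef_edge shift_edge)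
  then show ?thesis using assms edge_ends emb_tree by blast
qed

lemma emb_shift_down:
  assumes "s \<in> S" "emb s c \<in> U"
  shows "emb s (\<lambda>m. c (m + 1)) \<in> U"
proof -
  have "emb s1 c \<in> U" using assms edge_ends emb_tree by blast
  then have "emb t1 (\<lambda>m. c (m + 1)) \<in> U"
    using emb_transfer[of t1 s1 c] edge_ends cox_cos_edges emb_smult_iff[of "2 * cox_cos W t1 s1"]
    by (simp add: coef_edge shift_edge)
  then show ?thesis using assms edge_ends emb_tree by blast
qed

text \<open>The loop crosses the first edge upwards and the second one downwards: the two index shifts
  cancel and the factor \<open>2 powi (- m)\<close> of the second edge remains.\<close>

lemma emb_scale:
  assumes "s \<in> S" "emb s c \<in> U"
  shows "emb s (\<lambda>m. 2 powi (- m) * c m) \<in> U"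
proof -
  have "emb s2 (\<lambda>m. c (m - 1)) \<in> U" using assms edge_ends emb_tree emb_shift_up by blast
  \<comment> \<open>Since \<open>shift t2 s2 = - 1\<close>, the weight is
    \<open>coef t2 s2 (m + 1)\<close>, whose exponent is \<open>2 - (m + 1) = 1 - m\<close>.\<close>
  then have "emb t2 (\<lambda>m. (2 powi (1 - m) * cox_cos W t2 s2) * c m) \<in> U"
    using emb_transfer[of t2 s2 "\<lambda>m. c (m - 1)"] edge_ends
    by (simp add: coef_edge shift_edge)
  moreover have "2 powi (1 - m) * cox_cos W t2 s2 * c m
      = 2 * cox_cos W t2 s2 * (2 powi (- m) * c m)" for m
    using power_int_add[of "2::complex" 1 "- m"] by simp
  ultimately have "emb t2 (\<lambda>m. 2 powi (- m) * c m) \<in> U"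
    using emb_smult_iff[of "2 * cox_cos W t2 s2"] cox_cos_edges by simp
  then show ?thesis using assms edge_ends emb_tree by blast
qed

section \<open>Basis vectors in an invariant subspace\<close>

lemma \<alpha>_eq_emb: "\<alpha> t n = emb t (\<lambda>m. if m = n then 1 else 0)"
  by (auto simp: \<alpha>_def emb_def)

text \<open>Induction on the size of the support: as long as it has more than one point, one of them
  can be removed by means of the diagonal operator without losing the others.\<close>

lemma exists_\<alpha>_mem:
  assumes s: "s \<in> S"
    and "emb s c \<in> U" "finite {m. c m \<noteq> 0}" "{m. c m \<noteq> 0} \<noteq> {}"
  shows "\<exists>n. \<alpha> s n \<in> U"
  using assms(2-)
proof (induction "card {m. c m \<noteq> 0}" arbitrary: c rule: less_induct)
  case less
  obtain n where n: "c n \<noteq> 0" using less.prems by auto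
  show ?case
  proof (cases "{m. c m \<noteq> 0} = {n}")
    case True
    then have "c = (\<lambda>m. c n * (if m = n then 1 else 0))" by (auto simp: fun_eq_iff)
    then have "\<alpha> s n \<in> U"
      using less.prems(1) n emb_smult_iff[of "c n"] unfolding \<alpha>_eq_emb by metis
    then show ?thesis ..
  next
    case False
    \<comment> \<open>The diagonal operator minus its eigenvalue at \<open>n\<close> kills the entry
      at \<open>n\<close> and, the eigenvalues being distinct, no other nonzero entry.\<close>
    define d where "d m = (2 powi (- m) - 2 powi (- n)) * c m" for m
    have "emb s d = (\<lambda>b. emb s (\<lambda>m. 2 powi (- m) * c m) b + (- (2 powi (- n))) * emb s c b)"
      by (auto simp: emb_def d_def algebra_simps)
    then have "emb s d \<in> U"
      using add_mem[OF emb_scale[OF s less.prems(1)] smult_mem[OF less.prems(1), of "- (2 powi (- n))"]]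
      by simp
    moreover have supp: "{m. d m \<noteq> 0} = {m. c m \<noteq> 0} - {n}"
      by (auto simp: d_def powi_2_inj)
    moreover have "card ({m. c m \<noteq> 0} - {n}) < card {m. c m \<noteq> 0}"
      using less.prems(2) n by (intro psubset_card_mono) auto
    ultimately show ?thesis
      using less.hyps[of d] less.prems(2) False n by auto
  qed
qed

text \<open>The two shifts reach every index \<open>k\<close> at \<open>s\<close>, and the tree then
  leads from \<open>s\<close> to \<open>t\<close>.\<close>

lemma \<alpha>_mem:
  assumes s: "s \<in> S" "\<alpha> s n \<in> U" and t: "t \<in> S"
  shows "\<alpha> t k \<in> U"
proof -
  have "\<alpha> s k \<in> U"
    using s(2)
  proof (induction k rule: int_induct[of _ n])
    case (step1 i)
    have "(\<lambda>m. if m - 1 = i then 1 else 0) = (\<lambda>m. if m = i + 1 then 1 else (0::complex))" by auto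
    then show ?case using step1 emb_shift_up[OF s(1), of "\<lambda>m. if m = i then 1 else 0"]
      by (simp add: \<alpha>_eq_emb)
  next
    case (step2 i)
    have "(\<lambda>m. if m + 1 = i then 1 else 0) = (\<lambda>m. if m = i - 1 then 1 else (0::complex))" by auto
    then show ?case using step2 emb_shift_down[OF s(1), of "\<lambda>m. if m = i then 1 else 0"]
      by (simp add: \<alpha>_eq_emb)
  qed simp
  then show ?thesis
    unfolding \<alpha>_eq_emb by (rule emb_tree[OF t s(1)])
qed

lemma mem_if_\<alpha>_mem:
  assumes "\<And>t n. t \<in> S \<Longrightarrow> \<alpha> t n \<in> U" and "f \<in> carrier V"
  shows "f \<in> U"
  using assms(2)
proof (induction "card {x. f x \<noteq> 0}" arbitrary: f)
  case 0
  then have "f = (\<lambda>b. 0)" by (auto simp: cox_space_carrier)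
  then show ?case using zero_mem by simp
next
  case (Suc k)
  have "{x. f x \<noteq> 0} \<noteq> {}" using Suc.hyps(2) by (metis card.empty nat.distinct(1))
  then obtain t n where tn: "f (t, n) \<noteq> 0" by auto
  define g where "g = f((t, n) := 0)"
  have t: "t \<in> S" and fin: "finite {x. f x \<noteq> 0}" using tn Suc.prems by (auto simp: cox_space_carrier)
  have supp: "{x. g x \<noteq> 0} = {x. f x \<noteq> 0} - {(t, n)}" by (auto simp: g_def)
  then have "g \<in> U"
    using Suc tn fin by (intro Suc.hyps) (auto simp: cox_space_carrier)
  moreover have "f = (\<lambda>b. g b + f (t, n) * \<alpha> t n b)" by (auto simp: g_def \<alpha>_def)
  ultimately show ?case
    using add_mem[OF _ smult_mem[OF assms(1)[OF t]]] by metis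
qed

lemma eq_carrier:
  assumes "f \<in> U" "f \<notin> V0"
  shows "U = carrier V"
proof -
  have f: "f \<in> carrier V" using assms subset by auto
  then obtain s m where s: "s \<in> S" and "refl_coord s m f \<noteq> 0"
    using assms by (auto simp: fixed_iff)
  then obtain n where "\<alpha> s n \<in> U"
    using exists_\<alpha>_mem[OF s emb_refl_mem[OF s assms(1)]] finite_refl_coord[OF f] by blast
  then show ?thesis
    using \<alpha>_mem s mem_if_\<alpha>_mem subset by blast
qed

end

section \<open>Irreducibility and infinite dimension of the quotient\<close>

context circuit_rep
begin

text \<open>\<open>V0\<close> is maximal: a strictly larger invariant subspace contains a vector
  that is not fixed, and \<open>eq_carrier\<close> applies.\<close>

lemma irreducible_quotient:
  "irreducible_rep class_ring (quot_space V V0) W (\<lambda>w. quot_map V V0 (\<rho> w))"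
proof (rule rep.irreducible_quot_rep[OF subspace_fixed])
  show "\<rho> g f \<in> V0" if "g \<in> carrier W" "f \<in> V0" for g f
    using fixed_action[OF that] that by simp
  show "V0 \<noteq> carrier V"
    using \<alpha>_closed \<alpha>_not_fixed edge_ends by blast
  fix U assume U: "VectorSpace.subspace class_ring U V" "V0 \<subset> U"
    and inv: "\<And>g u. g \<in> carrier W \<Longrightarrow> u \<in> U \<Longrightarrow> \<rho> g u \<in> U"
  interpret U: submodule class_ring U V using U(1) by simp
  interpret circuit_subrep W S E0 s1 t1 s2 t2 U
  proof unfold_locales
    show "U \<subseteq> carrier V" by (rule U.subset)
    show "(\<lambda>b. 0) \<in> U" using U.zero_closed by simp
    show "(\<lambda>b. f b + g b) \<in> U" if "f \<in> U" "g \<in> U" for f g using U.m_closed[OF that] by simp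
    show "(\<lambda>b. c * f b) \<in> U" if "f \<in> U" for f c using U.smult_closed[OF _ that, of c] by simp
    show "act s f \<in> U" if "s \<in> S" "f \<in> U" for s f
      using inv[OF gens_in_carrier[OF that(1)] that(2)]
        action_gen[OF that(1) subsetD[OF U.subset that(2)]] by (rule subst[rotated])
  qed
  obtain f where "f \<in> U" "f \<notin> V0" using U(2) by blast
  then show "U = carrier V" by (rule eq_carrier)
qed

lemma infinite_dim_quotient: "\<not> vectorspace.fin_dim class_ring (quot_space V V0)"
proof
  let ?Q = "quot_space V V0"
  interpret Q: vectorspace class_ring ?Q by (rule rep.quot_space_vectorspace[OF subspace_fixed])
  assume "Q.fin_dim"
  then obtain A where A: "finite A" "A \<subseteq> carrier ?Q" "Q.span A = carrier ?Q"
    by (auto simp: Q.fin_dim_def)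
  have "\<forall>X\<in>A. \<exists>v\<in>carrier V. X = V0 +>\<^bsub>V\<^esub> v"
    using A(2) by (auto simp: rep.quot_space_simps(1))
  then obtain v where v: "\<And>X. X \<in> A \<Longrightarrow> v X \<in> carrier V \<and> X = V0 +>\<^bsub>V\<^esub> v X" by metis
  \<comment> \<open>The coordinates of \<open>(s1 - 1) f\<close> depend only on the coset of \<open>f\<close>; finitely many generators
    leave all but finitely many of them zero.\<close>
  define F where "F = (\<Union>X\<in>A. {m. refl_coord s1 m (v X) \<noteq> 0})"
  have "finite F" unfolding F_def using A(1) v finite_refl_coord by auto
  then obtain m where m: "m \<notin> F" using infinite_UNIV_int ex_new_if_finite by blast
  \<comment> \<open>The kernel of the functional that \<open>refl_coord s1 m\<close> induces on the
    quotient. By the choice of \<open>m\<close> it contains all generators in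
    \<open>A\<close>.\<close>
  define N where "N = (\<lambda>f. V0 +>\<^bsub>V\<^esub> f) ` {f \<in> carrier V. refl_coord s1 m f = 0}"
  interpret V0: submodule class_ring V0 V using subspace_fixed by simp
  interpret abelian_subgroup V0 V
    by (rule rep.abelian_subgroup_submodule) (rule V0.submodule_axioms)
  note [simp] = rep.quot_space_add_coset[OF subspace_fixed] rep.quot_space_smult_coset[OF subspace_fixed]
  have "submodule class_ring N ?Q"
  proof unfold_locales
    show "N \<subseteq> carrier ?Q" by (auto simp: N_def rep.quot_space_simps(1))
    show "\<zero>\<^bsub>?Q\<^esub> \<in> N"
      unfolding N_def rep.quot_space_simps(2) using V0.zero_closed
      by (intro image_eqI[of _ _ "\<lambda>b. 0"])
        (simp_all add: a_rcos_const refl_coord_zero cox_space_zero_closed)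
  next
    fix X Y assume "X \<in> N" "Y \<in> N"
    then obtain f g where fg: "f \<in> carrier V" "refl_coord s1 m f = 0" "X = V0 +>\<^bsub>V\<^esub> f"
      "g \<in> carrier V" "refl_coord s1 m g = 0" "Y = V0 +>\<^bsub>V\<^esub> g"
      by (auto simp: N_def)
    then have "X \<oplus>\<^bsub>?Q\<^esub> Y = V0 +>\<^bsub>V\<^esub> (\<lambda>b. f b + g b)" by simp
    then show "X \<oplus>\<^bsub>?Q\<^esub> Y \<in> N"
      using fg by (auto simp: N_def refl_coord_add cox_space_add_closed)
  next
    fix c :: complex and X assume "X \<in> N"
    then obtain f where f: "f \<in> carrier V" "refl_coord s1 m f = 0" "X = V0 +>\<^bsub>V\<^esub> f"
      by (auto simp: N_def)
    then have "c \<odot>\<^bsub>?Q\<^esub> X = V0 +>\<^bsub>V\<^esub> (\<lambda>b. c * f b)" by simp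
    then show "c \<odot>\<^bsub>?Q\<^esub> X \<in> N"
      using f by (auto simp: N_def refl_coord_smult cox_space_smult_closed)
  qed
  moreover have "A \<subseteq> N"
    using v m by (fastforce simp: N_def F_def)
  ultimately have "carrier ?Q \<subseteq> N" using Q.span_is_subset A(3) by metis
  moreover have closed: "\<alpha> s1 m \<in> carrier V" using \<alpha>_closed edge_ends by blast
  then have "V0 +>\<^bsub>V\<^esub> \<alpha> s1 m \<in> carrier ?Q" by (auto simp: rep.quot_space_simps(1))
  ultimately obtain f where f: "f \<in> carrier V" "refl_coord s1 m f = 0"
    "V0 +>\<^bsub>V\<^esub> \<alpha> s1 m = V0 +>\<^bsub>V\<^esub> f"
    by (auto simp: N_def)
  \<comment> \<open>The vectors \<open>f\<close> and \<open>\<alpha> s1 m\<close> differ by an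
    element of \<open>V0\<close>, where the functional vanishes, yet its value at
    \<open>\<alpha> s1 m\<close> is -2.\<close>
  then have "f \<in> V0 +>\<^bsub>V\<^esub> \<alpha> s1 m" using a_rcos_self by simp
  then obtain h where "h \<in> V0" "f = (\<lambda>b. h b + \<alpha> s1 m b)" by (auto simp: a_r_coset_def')
  then have "refl_coord s1 m (\<alpha> s1 m) = 0"
    using f(2) edge_ends by (auto simp: fixed_iff refl_coord_add)
  then show False using edge_ends by (simp add: refl_coord_\<alpha>)
qed

end

theorem theorem3p2:
  fixes W :: "('w, 'x) monoid_scheme" and S :: "'w set"
    and E0 :: "'w set set" and s1 t1 s2 t2 :: 'w
  assumes "coxeter_system W S"
    and "finite S"
    and "graph_connected S (cox_edges W S)"
    and "\<forall>s\<in>S. \<forall>t\<in>S. cox_m W s t \<noteq> 0"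
    and "at_least_two_circuits (cox_edges W S)"
    and "is_spanning_tree S (cox_edges W S) E0"
    and "{s1, t1} \<in> cox_edges W S - E0"
    and "{s2, t2} \<in> cox_edges W S - E0"
    and "{s1, t1} \<noteq> {s2, t2}"
  shows "let V = cox_space S;
             \<rho> = cox_action W S s1 t1 s2 t2;
             V0 = fixed_vectors V S \<rho>
         in irreducible_rep class_ring (quot_space V V0) W (\<lambda>w. quot_map V V0 (\<rho> w)) \<and>
            \<not> vectorspace.fin_dim class_ring (quot_space V V0)"
proof -
  interpret circuit_rep W S E0 s1 t1 s2 t2
    using assms by (simp add: circuit_rep_def circuit_rep_axioms_def)
  show ?thesis
    unfolding Let_def using irreducible_quotient infinite_dim_quotient by blast
qed

end
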